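(* Let $l\geqslant 1$ be an integer and let $n\geqslant l+4$ be an integer. Then $$\kappa_l(n,4)=\begin{cases}\lfloor (n+l)/2\rfloor, & l+4\leqslant n<2l;\\ \lfloor (3n+6l)/8\rfloor, & \max\{2l,l+4\}\leqslant n<6l;\\ \lfloor (n+6l)/4\rfloor, & n\geqslant 6l.\end{cases}$$
   Context: For a positive integer $n$, $[n]=\{1,\ldots,n\}$. A family $\mathcal{F}$ of subsets of $[n]$ is an $m$-family if it has $m$ members (required to be pairwise distinct subsets); it is $k$-uniform if every member has size $k$; for a set $L$ of nonnegative integers it is $L$-intersecting if $|F\cap F'|\in L$ for every two distinct members $F,F'$. $\kappa_{L}(n,m)$ denotes the maximum $k$ such that there exists a $k$-uniform $L$-intersecting $m$-family of subsets of $[n]$ (and $-\infty$ if none exists), and $\kappa_l(n,m)$ denotes $\kappa_{\{l\}}(n,m)$. *)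

theory Defs
  imports Complex_Main "HOL-Library.Extended_Real"
begin

definition uniform_family :: "nat \<Rightarrow> nat set set \<Rightarrow> bool" where
  "uniform_family k \<F> \<longleftrightarrow> (\<forall>F\<in>\<F>. card F = k)"

definition intersecting_family :: "nat set \<Rightarrow> nat set set \<Rightarrow> bool" where
  "intersecting_family L \<F> \<longleftrightarrow> (\<forall>F\<in>\<F>. \<forall>F'\<in>\<F>. F \<noteq> F' \<longrightarrow> card (F \<inter> F') \<in> L)"

definition m_family :: "nat \<Rightarrow> nat \<Rightarrow> nat set set \<Rightarrow> bool" where
  "m_family n m \<F> \<longleftrightarrow> \<F> \<subseteq> Pow {1..n} \<and> card \<F> = m"

definition feasible_sizes :: "nat set \<Rightarrow> nat \<Rightarrow> nat \<Rightarrow> nat set" where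
  "feasible_sizes L n m =
     {k. \<exists>\<F>. m_family n m \<F> \<and> uniform_family k \<F> \<and> intersecting_family L \<F>}"

text \<open>For \<open>m \<ge> 1\<close> the set of feasible sizes is bounded by \<open>n\<close>, so \<open>Max\<close> is a genuine maximum.
  The case \<open>m = 0\<close>, where the set is all of \<open>\<nat>\<close>, is not meaningful.\<close>

definition kappa_set :: "nat set \<Rightarrow> nat \<Rightarrow> nat \<Rightarrow> ereal" where
  "kappa_set L n m =
     (if feasible_sizes L n m = {} then -\<infinity> else ereal (real (Max (feasible_sizes L n m))))"

abbreviation kappa :: "nat \<Rightarrow> nat \<Rightarrow> nat \<Rightarrow> ereal" where
  "kappa l n m \<equiv> kappa_set {l} n m"

end

theory Submission
  imports Defs "HOL-Library.Disjoint_Sets"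
begin

text \<open>
  Upper bounds: let \<open>d x\<close> be the number of members containing the point \<open>x\<close>. For every integer \<open>r\<close>
  we have \<open>(d x - r) (d x - r - 1) \<ge> 0\<close>. Summing over \<open>x\<close>, with \<open>\<Sum>d = m k\<close> and
  \<open>\<Sum>d (d - 1) = m (m - 1) l\<close>, gives \<open>2 r m k \<le> r (r + 1) n + m (m - 1) l\<close>; for \<open>m = 4\<close> the three
  cases of the theorem are \<open>r = 3, 2, 1\<close>.

  Lower bounds: a family of four sets is determined up to isomorphism by the sizes of the 15 regions
  of its Venn diagram. Once the sizes \<open>a\<close> of the fourfold and \<open>t\<^sub>0, \<dots>, t\<^sub>3\<close> of the threefold regions
  are chosen, \<open>l\<close> and \<open>k\<close> determine the rest, and only their nonnegativity and the total size remain
  to be checked.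
\<close>

section \<open>Upper bound from point degrees\<close>

lemma degree_bound:
  assumes F: "m_family n m \<F>" "uniform_family k \<F>" "intersecting_family {l} \<F>"
  shows "2 * r * m * k \<le> r * (r + 1) * n + m * (m - 1) * l"
proof -
  define V where "V = {1..n}"
  \<comment> \<open>Degrees are taken in \<open>int\<close> because \<open>d x - r\<close> may be
    negative.\<close>
  define d :: "nat \<Rightarrow> int" where "d x = (\<Sum>F\<in>\<F>. of_bool (x \<in> F))" for x
  have sub: "\<F> \<subseteq> Pow V" and m: "card \<F> = m" and V: "finite V" "card V = n"
    using F(1) by (auto simp: m_family_def V_def)
  have fin: "finite \<F>"
    using sub V(1) by (meson finite_Pow_iff finite_subset)
  have inc: "(\<Sum>x\<in>V. of_bool (x \<in> A)) = int (card A)" if "A \<subseteq> V" for A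
    using that V(1) by (simp add: sum.If_cases of_bool_def Int_absorb1)
  have d1: "(\<Sum>x\<in>V. d x) = int m * int k"
  proof -
    have "(\<Sum>x\<in>V. d x) = (\<Sum>F\<in>\<F>. \<Sum>x\<in>V. of_bool (x \<in> F))"
      unfolding d_def by (rule sum.swap)
    also have "\<dots> = (\<Sum>F\<in>\<F>. int k)"
      using sub F(2) by (intro sum.cong refl) (auto simp: inc uniform_family_def)
    finally show ?thesis by (simp add: m)
  qed
  have d2: "(\<Sum>x\<in>V. d x * d x) = int m * int k + int (m * (m - 1) * l)"
  proof -
    \<comment> \<open>\<open>d x * d x\<close> counts ordered pairs of members through
      \<open>x\<close>; diagonal pairs contribute \<open>k\<close>, the others
      \<open>l\<close>.\<close>
    have "(\<Sum>x\<in>V. d x * d x) = (\<Sum>x\<in>V. \<Sum>F\<in>\<F>. \<Sum>G\<in>\<F>. of_bool (x \<in> F \<inter> G))"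
      unfolding d_def sum_product by (intro sum.cong refl) (auto simp: of_bool_def)
    also have "\<dots> = (\<Sum>F\<in>\<F>. \<Sum>x\<in>V. \<Sum>G\<in>\<F>. of_bool (x \<in> F \<inter> G))"
      by (rule sum.swap)
    also have "\<dots> = (\<Sum>F\<in>\<F>. \<Sum>G\<in>\<F>. \<Sum>x\<in>V. of_bool (x \<in> F \<inter> G))"
      by (intro sum.cong refl sum.swap)
    also have "\<dots> = (\<Sum>F\<in>\<F>. \<Sum>G\<in>\<F>. int (card (F \<inter> G)))"
      using sub by (intro sum.cong refl inc) auto
    also have "\<dots> = (\<Sum>F\<in>\<F>. int k + int ((m - 1) * l))"
    proof (rule sum.cong[OF refl])
      fix F assume "F \<in> \<F>"
      have "(\<Sum>G\<in>\<F>. int (card (F \<inter> G)))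
          = int (card (F \<inter> F)) + (\<Sum>G\<in>\<F> - {F}. int (card (F \<inter> G)))"
        using fin \<open>F \<in> \<F>\<close> by (rule sum.remove)
      also have "(\<Sum>G\<in>\<F> - {F}. int (card (F \<inter> G))) = (\<Sum>G\<in>\<F> - {F}. int l)"
        using F(3) \<open>F \<in> \<F>\<close> by (intro sum.cong refl) (auto simp: intersecting_family_def)
      finally show "(\<Sum>G\<in>\<F>. int (card (F \<inter> G))) = int k + int ((m - 1) * l)"
        using F(2) \<open>F \<in> \<F>\<close> fin by (simp add: uniform_family_def m)
    qed
    finally show ?thesis by (simp add: m distrib_left mult.assoc)
  qed
  have "2 * int r * d x \<le> int r * (int r + 1) + (d x * d x - d x)" for x
  proof -
    have "0 \<le> (d x - r) * (d x - r - 1)"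
      by (cases "d x \<le> r") (auto intro: mult_nonpos_nonpos mult_nonneg_nonneg)
    then show ?thesis by (simp add: algebra_simps)
  qed
  then have "(\<Sum>x\<in>V. 2 * int r * d x) \<le> (\<Sum>x\<in>V. int r * (int r + 1) + (d x * d x - d x))"
    by (rule sum_mono)
  then have "2 * int r * (int m * int k) \<le> int n * (int r * (int r + 1)) + int (m * (m - 1) * l)"
    by (simp add: sum.distrib sum_subtractf V d1 d2 flip: sum_distrib_left)
  then have "int (2 * r * m * k) \<le> int (r * (r + 1) * n + m * (m - 1) * l)"
    by (simp add: distrib_left distrib_right ac_simps)
  then show ?thesis by linarith
qed

section \<open>Realizing prescribed Venn regions\<close>

lemma disjoint_family_with_cards:
  fixes c :: "'i \<Rightarrow> nat"
  assumes "finite I" "finite X" "sum c I \<le> card X"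
  shows "\<exists>A. disjoint_family_on A I \<and> (\<forall>i\<in>I. A i \<subseteq> X \<and> card (A i) = c i)"
  using assms(1,3)
proof (induction I)
  case empty
  then show ?case by (simp add: disjoint_family_on_def)
next
  case (insert j I)
  then obtain A where A: "disjoint_family_on A I" "\<forall>i\<in>I. A i \<subseteq> X \<and> card (A i) = c i"
    by auto
  define U where "U = (\<Union>i\<in>I. A i)"
  have U: "U \<subseteq> X" using A by (auto simp: U_def)
  have "card U = sum c I"
    unfolding U_def using A insert.hyps \<open>finite X\<close>
    by (subst card_UN_disjoint) (auto simp: disjoint_family_on_def intro: finite_subset[of _ X])
  then have "c j \<le> card (X - U)"
    using insert U \<open>finite X\<close> by (simp add: card_Diff_subset finite_subset)
  then obtain B where B: "B \<subseteq> X - U" "card B = c j"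
    by (meson obtain_subset_with_card_n)
  have "disjoint_family_on (A(j := B)) (insert j I)"
    using A(1) B(1) insert.hyps by (auto simp: disjoint_family_on_def U_def)
  moreover have "\<forall>i\<in>insert j I. (A(j := B)) i \<subseteq> X \<and> card ((A(j := B)) i) = c i"
    using A(2) B insert.hyps by auto
  ultimately show ?case by blast
qed

text \<open>\<open>c S\<close> prescribes the size of the Venn region of points lying in exactly the members with index
  in \<open>S\<close>.\<close>

lemma feasible_of_regions:
  fixes c :: "nat set \<Rightarrow> nat"
  assumes "l < k"
    and "sum c (Pow {..<m}) \<le> n"
    and incid: "\<And>i j. i < m \<Longrightarrow> j < m \<Longrightarrow>
      (\<Sum>S\<in>Pow {..<m}. if i \<in> S \<and> j \<in> S then c S else 0) = (if i = j then k else l)"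
  shows "k \<in> feasible_sizes {l} n m"
proof -
  have "\<exists>A. disjoint_family_on A (Pow {..<m}) \<and> (\<forall>S\<in>Pow {..<m}. A S \<subseteq> {1..n} \<and> card (A S) = c S)"
    using assms(2) by (intro disjoint_family_with_cards) auto
  then obtain A where A: "disjoint_family_on A (Pow {..<m})"
      "\<And>S. S \<subseteq> {..<m} \<Longrightarrow> A S \<subseteq> {1..n}" "\<And>S. S \<subseteq> {..<m} \<Longrightarrow> card (A S) = c S"
    by auto
  have fin: "finite (A S)" if "S \<subseteq> {..<m}" for S
    using A(2)[OF that] by (rule finite_subset) simp
  define F where "F i = (\<Union>S\<in>{S\<in>Pow {..<m}. i \<in> S}. A S)" for i
  have card_F: "card (F i \<inter> F j) = (if i = j then k else l)" if "i < m" "j < m" for i j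
  proof -
    \<comment> \<open>Disjointness puts each point in one region only, so the indices
      \<open>i\<close> and \<open>j\<close> belong to the same \<open>S\<close>.\<close>
    have "F i \<inter> F j = (\<Union>S\<in>{S\<in>Pow {..<m}. i \<in> S \<and> j \<in> S}. A S)"
      using A(1) unfolding F_def disjoint_family_on_def by blast
    also have "card \<dots> = (\<Sum>S\<in>{S\<in>Pow {..<m}. i \<in> S \<and> j \<in> S}. card (A S))"
      using A(1) fin by (intro card_UN_disjoint) (auto simp: disjoint_family_on_def)
    also have "\<dots> = (\<Sum>S\<in>{S\<in>Pow {..<m}. i \<in> S \<and> j \<in> S}. c S)"
      using A(3) by (intro sum.cong) auto
    also have "\<dots> = (\<Sum>S\<in>Pow {..<m}. if i \<in> S \<and> j \<in> S then c S else 0)"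
      by (rule sum.inter_filter) simp
    finally show ?thesis using incid that by simp
  qed
  have inj: "inj_on F {..<m}"
  proof (rule inj_onI, rule ccontr)
    fix i j assume "i \<in> {..<m}" "j \<in> {..<m}" "F i = F j" "i \<noteq> j"
    then show False using card_F[of i j] card_F[of i i] \<open>l < k\<close> by auto
  qed
  have "F i \<subseteq> {1..n}" for i
    using A(2) unfolding F_def by blast
  then have "m_family n m (F ` {..<m})"
    unfolding m_family_def using inj by (auto simp: card_image)
  moreover have "uniform_family k (F ` {..<m})"
    unfolding uniform_family_def using card_F by fastforce
  moreover have "intersecting_family {l} (F ` {..<m})"
    unfolding intersecting_family_def using card_F by auto
  ultimately show ?thesis unfolding feasible_sizes_def by blast
qed

text \<open>Used as a rewrite rule to expand sums over \<open>Pow {0, 1, 2, 3}\<close> into explicit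
  terms.\<close>

lemma sum_Pow_insert:
  assumes "finite A" "x \<notin> A"
  shows "sum f (Pow (insert x A)) = sum f (Pow A) + (\<Sum>S\<in>Pow A. f (insert x S))"
proof -
  have "inj_on (insert x) (Pow A)"
    using assms(2) by (auto simp: inj_on_def)
  moreover have "Pow A \<inter> insert x ` Pow A = {}"
    using assms(2) by auto
  ultimately show ?thesis
    using assms(1) by (simp add: Pow_insert sum.union_disjoint sum.reindex)
qed

text \<open>\<open>ti\<close> is the size of the region missed by member \<open>i\<close> alone. As
  the \<open>ti\<close> decrease, \<open>pair\<close> and \<open>single\<close> are the tightest
  nonnegativity conditions on the twofold and onefold regions; \<open>total\<close> bounds the sum
  of all regions by \<open>n\<close>.\<close>

lemma feasible_four:
  fixes a t0 t1 t2 t3 :: nat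
  assumes "l < k" and t: "t3 \<le> t2" "t2 \<le> t1" "t1 \<le> t0"
    and pair: "a + t0 + t1 \<le> l"
    and single: "3 * l \<le> k + 2 * a + t1 + t2 + t3"
    and total: "4 * k + 3 * a + (t0 + t1 + t2 + t3) \<le> n + 6 * l"
  shows "k \<in> feasible_sizes {l} n 4"
proof -
  define t where "t i = [t0, t1, t2, t3] ! i" for i
  \<comment> \<open>\<open>u\<close> adds the \<open>t i\<close> of the members missing from
    \<open>S\<close>. The empty region gets 0: points in no member are just left over.\<close>
  define c where "c S = (let u = \<Sum>i\<in>{..<4} - S. t i in
      if card S = 1 then k + 2 * a + u - 3 * l else if card S = 2 then l - a - u
      else if card S = 3 then u else if card S = 4 then a else 0)" for S :: "nat set"
  have lt4: "{..<4} = {0, 1, 2, 3::nat}" by auto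
  have C: "c {} = 0"
    "c {0} = k + 2 * a + (t1 + t2 + t3) - 3 * l" "c {1} = k + 2 * a + (t0 + t2 + t3) - 3 * l"
    "c {2} = k + 2 * a + (t0 + t1 + t3) - 3 * l" "c {3} = k + 2 * a + (t0 + t1 + t2) - 3 * l"
    "c {0,1} = l - a - (t2 + t3)" "c {0,2} = l - a - (t1 + t3)" "c {0,3} = l - a - (t1 + t2)"
    "c {1,2} = l - a - (t0 + t3)" "c {1,3} = l - a - (t0 + t2)" "c {2,3} = l - a - (t0 + t1)"
    "c {0,1,2} = t3" "c {0,1,3} = t2" "c {0,2,3} = t1" "c {1,2,3} = t0" "c {0,1,2,3} = a"
    unfolding c_def lt4 by (simp_all add: Let_def insert_Diff_if t_def)
  \<comment> \<open>Additive forms, certifying that none of the subtractions truncates.\<close>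
  have E:
    "c {0} + 3 * l = k + 2 * a + (t1 + t2 + t3)" "c {1} + 3 * l = k + 2 * a + (t0 + t2 + t3)"
    "c {2} + 3 * l = k + 2 * a + (t0 + t1 + t3)" "c {3} + 3 * l = k + 2 * a + (t0 + t1 + t2)"
    "c {0,1} + a + (t2 + t3) = l" "c {0,2} + a + (t1 + t3) = l" "c {0,3} + a + (t1 + t2) = l"
    "c {1,2} + a + (t0 + t3) = l" "c {1,3} + a + (t0 + t2) = l" "c {2,3} + a + (t0 + t1) = l"
    unfolding C using t pair single by linarith+
  show ?thesis
  proof (rule feasible_of_regions[of l k c])
    have "sum c (Pow {..<4}) + 6 * l = 4 * k + 3 * a + (t0 + t1 + t2 + t3)"
      unfolding lt4 by (simp add: sum_Pow_insert C(1,12-) del: One_nat_def) (use E in linarith)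
    then show "sum c (Pow {..<4}) \<le> n" using total by linarith
  next
    fix i j :: nat assume "i < 4" "j < 4"
    then have "i \<in> {0, 1, 2, 3}" "j \<in> {0, 1, 2, 3}" by auto
    then show "(\<Sum>S\<in>Pow {..<4}. if i \<in> S \<and> j \<in> S then c S else 0) = (if i = j then k else l)"
      unfolding lt4
      by (elim insertE emptyE; simp add: sum_Pow_insert C(1,12-) del: One_nat_def)
        (use E in linarith)+
  qed fact
qed

section \<open>Extremal values in the three ranges\<close>

lemma kappa_eqI:
  assumes "k \<in> feasible_sizes L n m" "\<And>k'. k' \<in> feasible_sizes L n m \<Longrightarrow> k' \<le> k"
  shows "kappa_set L n m = ereal (real k)"
proof -
  have "finite (feasible_sizes L n m)"
    using assms(2) by (meson finite_nat_set_iff_bounded_le)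
  then have "Max (feasible_sizes L n m) = k"
    using assms by (intro Max_eqI)
  then show ?thesis using assms(1) by (auto simp: kappa_set_def)
qed

lemma feasible_four_le:
  assumes "k \<in> feasible_sizes {l} n 4"
  shows "2 * k \<le> n + l" "8 * k \<le> 3 * n + 6 * l" "4 * k \<le> n + 6 * l"
proof -
  have "2 * r * 4 * k \<le> r * (r + 1) * n + 4 * (4 - 1) * l" for r
    using assms degree_bound[of n 4 _ k l r] unfolding feasible_sizes_def by blast
  from this[of 3] this[of 2] this[of 1]
  show "2 * k \<le> n + l" "8 * k \<le> 3 * n + 6 * l" "4 * k \<le> n + 6 * l" by simp_all
qed

text \<open>No point lies in three members; \<open>6 * l \<le> n\<close> yields
  \<open>k \<ge> 3 * l\<close>, room for three disjoint pair regions in each member.\<close>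

lemma feasible_four_large:
  assumes "1 \<le> l" "6 * l \<le> n"
  shows "(n + 6 * l) div 4 \<in> feasible_sizes {l} n 4"
  by (rule feasible_four[of _ _ 0 0 0 0 0]) (use assms in linarith)+

text \<open>With these sizes all onefold and twofold regions vanish, so only degrees 3 and 4
  occur.\<close>

lemma feasible_four_small:
  assumes "l + 4 \<le> n" "n < 2 * l"
  shows "(n + l) div 2 \<in> feasible_sizes {l} n 4"
proof -
  define h where "h = (n - l) div 2"
  have "(n + l) div 2 = l + h" "1 \<le> h" "2 * h \<le> l" "l + 2 * h \<le> n"
    using assms unfolding h_def by linarith+
  then show ?thesis by (intro feasible_four[of _ _ h h h h "l - 2 * h"]) auto
qed

lemma feasible_four_medium:
  assumes "1 \<le> l" "l + 4 \<le> n" "2 * l \<le> n" "n < 6 * l"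
  shows "(3 * n + 6 * l) div 8 \<in> feasible_sizes {l} n 4"
proof -
  define k where "k = (3 * n + 6 * l) div 8"
  have k: "8 * k \<le> 3 * n + 6 * l" "3 * n + 6 * l < 8 * k + 8" unfolding k_def by linarith+
  have "l < k" using k assms by linarith
  have "k \<in> feasible_sizes {l} n 4"
  proof (cases "2 * k + 1 = 3 * l \<or> 2 * k = 3 * l + 1")
    case True
    \<comment> \<open>Here \<open>l\<close> is odd and \<open>a = 0\<close> would force two \<open>t\<^sub>i\<close> with sum exceeding \<open>l\<close>, so \<open>a = 1\<close> is needed.\<close>
    then have "odd l" by presburger
    then obtain u where u: "l = 2 * u + 1" by (rule oddE)
    show ?thesis
    proof (cases "2 * k + 1 = 3 * l")
      case True
      then show ?thesis using k assms u \<open>l < k\<close> by (intro feasible_four[of _ _ u u u u 1]) auto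
    next
      case False
      then have "2 * k = 3 * l + 1" using True by simp
      \<comment> \<open>If \<open>u = 0\<close>, then \<open>u - 1\<close> truncates to 0 and
        \<open>total\<close> needs \<open>n \<ge> 5\<close>, which is
        \<open>l + 4 \<le> n\<close>.\<close>
      then show ?thesis using k assms u \<open>l < k\<close>
        by (intro feasible_four[of _ _ "u - 1" u u u 1]) auto
    qed
  next
    case False
    \<comment> \<open>For \<open>a = 0\<close>, \<open>single\<close> asks for
      \<open>t1 + t2 + t3 \<ge> q\<close>. Below, \<open>q\<close> is split as evenly as possible
      and \<open>t0 = t1\<close>; \<open>total\<close> then follows from
      \<open>8 * k \<le> 3 * n + 6 * l\<close> by divisibility by 3.\<close>
    define q where "q = 3 * l - k"
    define u where "u = q div 3"
    have q: "k + q = 3 * l" using k assms unfolding q_def by linarith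
    \<comment> \<open>\<open>2 * l \<le> n\<close> gives \<open>2 * k + 1 \<ge> 3 * l\<close>, and
      the two excluded cases leave the slack that \<open>t0 + t1 \<le> l\<close> needs when
      \<open>q / 3\<close> is rounded up.\<close>
    have half: "2 * q = 3 * l \<or> 2 * q + 2 \<le> 3 * l" using q k assms False by linarith
    have "q = 3 * u \<or> q = 3 * u + 1 \<or> q = 3 * u + 2" unfolding u_def by linarith
    then show ?thesis
    proof (elim disjE)
      assume v: "q = 3 * u"
      have "2 * u \<le> l" using half v by linarith
      then show ?thesis
        by (intro feasible_four[of _ _ u u u u 0]) (use v q k \<open>l < k\<close> in linarith)+
    next
      assume v: "q = 3 * u + 1"
      have "2 * u + 2 \<le> l" using half unfolding v by presburger
      then show ?thesis
        by (intro feasible_four[of _ _ u u "u + 1" "u + 1" 0]) (use v q k \<open>l < k\<close> in linarith)+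
    next
      assume v: "q = 3 * u + 2"
      have "2 * u + 2 \<le> l" using half unfolding v by presburger
      then show ?thesis
        by (intro feasible_four[of _ _ u "u + 1" "u + 1" "u + 1" 0])
          (use v q k \<open>l < k\<close> in linarith)+
    qed
  qed
  then show ?thesis by (simp add: k_def)
qed

theorem theorem2p4:
  fixes l n :: nat
  assumes "l \<ge> 1" and "n \<ge> l + 4"
  shows "(l + 4 \<le> n \<and> n < 2 * l \<longrightarrow>
            kappa l n 4 = ereal (of_int \<lfloor>(real n + real l) / 2\<rfloor>)) \<and>
         (max (2 * l) (l + 4) \<le> n \<and> n < 6 * l \<longrightarrow>
            kappa l n 4 = ereal (of_int \<lfloor>(3 * real n + 6 * real l) / 8\<rfloor>)) \<and>
         (n \<ge> 6 * l \<longrightarrow>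
            kappa l n 4 = ereal (of_int \<lfloor>(real n + 6 * real l) / 4\<rfloor>))"
proof -
  have fl: "\<lfloor>(real n + real l) / 2\<rfloor> = int ((n + l) div 2)"
    "\<lfloor>(3 * real n + 6 * real l) / 8\<rfloor> = int ((3 * n + 6 * l) div 8)"
    "\<lfloor>(real n + 6 * real l) / 4\<rfloor> = int ((n + 6 * l) div 4)"
    using floor_divide_of_nat_eq[of "n + l" 2, where 'a = real]
      floor_divide_of_nat_eq[of "3 * n + 6 * l" 8, where 'a = real]
      floor_divide_of_nat_eq[of "n + 6 * l" 4, where 'a = real]
    by simp_all
  have small: "kappa l n 4 = ereal (real ((n + l) div 2))" if "n < 2 * l"
    using feasible_four_small that assms by (intro kappa_eqI) (auto dest: feasible_four_le(1))
  have medium: "kappa l n 4 = ereal (real ((3 * n + 6 * l) div 8))" if "2 * l \<le> n" "n < 6 * l"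
    using feasible_four_medium that assms by (intro kappa_eqI) (auto dest: feasible_four_le(2))
  have large: "kappa l n 4 = ereal (real ((n + 6 * l) div 4))" if "6 * l \<le> n"
    using feasible_four_large that assms by (intro kappa_eqI) (auto dest: feasible_four_le(3))
  show ?thesis
    unfolding fl using small medium large by simp
qed

end
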